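(* Let $\mathcal{L}_\land\subseteq\{\land,\lor,\to,\lnot,0,1\}$ be a language containing $\land$, and let $\Phi$ be a Sahlqvist quasiequation in $\mathcal{L}_\land$. If an $\mathcal{L}_\land$-subreduct $\boldsymbol{A}$ of a Heyting algebra validates $\Phi$, then the Heyting algebra $\mathsf{Up}(\boldsymbol{A}_\ast)$ validates $\Phi$.
   Context: Formulas are built from variables using $\land,\lor,\to$ (binary), $\lnot$ (unary) and constants $0,1$. An occurrence of a variable in a formula is positive (resp. negative) if the number of negations and antecedents of implications in whose scope it lies is even (resp. odd); a formula is positive (resp. negative) if all variable occurrences in it are positive (resp. negative). A Sahlqvist antecedent is a formula constructed from variables, negative formulas and the constants $0,1$ using only $\land,\lor$. A Sahlqvist implication is a formula that is positive, or of the form $\lnot\varphi$ with $\varphi$ a Sahlqvist antecedent, or of the form $\varphi\to\psi$ with $\varphi$ a Sahlqvist antecedent and $\psi$ positive. A Sahlqvist quasiequation is a universally quantified sentence $\varphi_1\land y\le z\,\&\cdots\&\,\varphi_n\land y\le z\Longrightarrow y\le z$, where $y,z$ are distinct variables not occurring in $\varphi_1,\dots,\varphi_n$, each $\varphi_i$ is built from Sahlqvist implications using only $\land,\lor$, and $a\le b$ abbreviates the equation $a\land b\approx a$; it is in $\mathcal{L}_\land$ if all symbols in the $\varphi_i$ are in $\mathcal{L}_\land$. An $\mathcal{L}_\land$-subreduct of a Heyting algebra is a subalgebra of its reduct to $\mathcal{L}_\land$. For such $\boldsymbol{A}$, a filter is a nonempty upset (w.r.t. $a\le b\iff a\land b=a$)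 closed under $\land$, meet irreducible if proper and not the intersection of two filters both different from it, and $\boldsymbol{A}_\ast$ is the poset of meet irreducible filters under inclusion. For a poset $\mathbb{X}$, $\mathsf{Up}(\mathbb{X})=\langle\mathsf{Up}(\mathbb{X});\cap,\cup,\to,\emptyset,X\rangle$ is the Heyting algebra of upsets with $U\to V=X\smallsetminus{\downarrow}(U\smallsetminus V)$. *)

theory Defs
  imports Main
begin

datatype fm = Var nat | Bot | Top | And fm fm | Or fm fm | Imp fm fm | Neg fm

datatype sym = SAnd | SOr | SImp | SNeg | SBot | STop

fun syms :: "fm \<Rightarrow> sym set" where
  "syms (Var n) = {}"
| "syms Bot = {SBot}"
| "syms Top = {STop}"
| "syms (And a b) = insert SAnd (syms a \<union> syms b)"
| "syms (Or a b) = insert SOr (syms a \<union> syms b)"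
| "syms (Imp a b) = insert SImp (syms a \<union> syms b)"
| "syms (Neg a) = insert SNeg (syms a)"

fun vars :: "fm \<Rightarrow> nat set" where
  "vars (Var n) = {n}"
| "vars Bot = {}"
| "vars Top = {}"
| "vars (And a b) = vars a \<union> vars b"
| "vars (Or a b) = vars a \<union> vars b"
| "vars (Imp a b) = vars a \<union> vars b"
| "vars (Neg a) = vars a"

fun polar :: "bool \<Rightarrow> fm \<Rightarrow> bool" where
  "polar p (Var n) = p"
| "polar p Bot = True"
| "polar p Top = True"
| "polar p (And a b) = (polar p a \<and> polar p b)"
| "polar p (Or a b) = (polar p a \<and> polar p b)"
| "polar p (Imp a b) = (polar (\<not> p) a \<and> polar p b)"
| "polar p (Neg a) = polar (\<not> p) a"

definition positive :: "fm \<Rightarrow> bool" where "positive f = polar True f"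
definition negative :: "fm \<Rightarrow> bool" where "negative f = polar False f"

inductive sahl_ant :: "fm \<Rightarrow> bool" where
  sa_var: "sahl_ant (Var n)"
| sa_neg: "negative f \<Longrightarrow> sahl_ant f"
| sa_bot: "sahl_ant Bot"
| sa_top: "sahl_ant Top"
| sa_and: "sahl_ant a \<Longrightarrow> sahl_ant b \<Longrightarrow> sahl_ant (And a b)"
| sa_or: "sahl_ant a \<Longrightarrow> sahl_ant b \<Longrightarrow> sahl_ant (Or a b)"

definition sahl_imp :: "fm \<Rightarrow> bool" where
  "sahl_imp f \<longleftrightarrow> positive f
     \<or> (\<exists>a. f = Neg a \<and> sahl_ant a)
     \<or> (\<exists>a b. f = Imp a b \<and> sahl_ant a \<and> positive b)"

inductive sahl_comb :: "fm \<Rightarrow> bool" where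
  sc_imp: "sahl_imp f \<Longrightarrow> sahl_comb f"
| sc_and: "sahl_comb a \<Longrightarrow> sahl_comb b \<Longrightarrow> sahl_comb (And a b)"
| sc_or: "sahl_comb a \<Longrightarrow> sahl_comb b \<Longrightarrow> sahl_comb (Or a b)"

text \<open>The quasiequation  phi_1 /\ y <= z & ... & phi_n /\ y <= z ==> y <= z
  is represented by the list [phi_1,...,phi_n] and the variable indices y, z.\<close>
definition sahlqvist_qe :: "fm list \<Rightarrow> nat \<Rightarrow> nat \<Rightarrow> bool" where
  "sahlqvist_qe phis y z \<longleftrightarrow> y \<noteq> z \<and>
     (\<forall>f\<in>set phis. sahl_comb f \<and> y \<notin> vars f \<and> z \<notin> vars f)"

definition qe_in_lang :: "sym set \<Rightarrow> fm list \<Rightarrow> bool" where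
  "qe_in_lang L phis \<longleftrightarrow> (\<forall>f\<in>set phis. syms f \<subseteq> L)"

record 'a halg =
  car :: "'a set"
  mt :: "'a \<Rightarrow> 'a \<Rightarrow> 'a"
  jn :: "'a \<Rightarrow> 'a \<Rightarrow> 'a"
  im :: "'a \<Rightarrow> 'a \<Rightarrow> 'a"
  ng :: "'a \<Rightarrow> 'a"
  bt :: "'a"
  tp :: "'a"

definition ale :: "('a, 'b) halg_scheme \<Rightarrow> 'a \<Rightarrow> 'a \<Rightarrow> bool" where
  "ale A a b \<longleftrightarrow> mt A a b = a"

definition heyting_algebra :: "('a, 'b) halg_scheme \<Rightarrow> bool" where
  "heyting_algebra A \<longleftrightarrow>
     bt A \<in> car A \<and> tp A \<in> car A \<and>
     (\<forall>a\<in>car A. \<forall>b\<in>car A. mt A a b \<in> car A \<and> jn A a b \<in> car A \<and> im A a b \<in> car A) \<and>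
     (\<forall>a\<in>car A. ng A a \<in> car A \<and> ng A a = im A a (bt A)) \<and>
     (\<forall>a\<in>car A. mt A a a = a \<and> jn A a a = a) \<and>
     (\<forall>a\<in>car A. \<forall>b\<in>car A. mt A a b = mt A b a \<and> jn A a b = jn A b a \<and>
        mt A a (jn A a b) = a \<and> jn A a (mt A a b) = a) \<and>
     (\<forall>a\<in>car A. \<forall>b\<in>car A. \<forall>c\<in>car A.
        mt A a (mt A b c) = mt A (mt A a b) c \<and> jn A a (jn A b c) = jn A (jn A a b) c) \<and>
     (\<forall>a\<in>car A. ale A (bt A) a \<and> ale A a (tp A)) \<and>
     (\<forall>a\<in>car A. \<forall>b\<in>car A. \<forall>c\<in>car A. ale A (mt A c a) b \<longleftrightarrow> ale A c (im A a b))"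

fun eval :: "('a, 'b) halg_scheme \<Rightarrow> (nat \<Rightarrow> 'a) \<Rightarrow> fm \<Rightarrow> 'a" where
  "eval A v (Var n) = v n"
| "eval A v Bot = bt A"
| "eval A v Top = tp A"
| "eval A v (And a b) = mt A (eval A v a) (eval A v b)"
| "eval A v (Or a b) = jn A (eval A v a) (eval A v b)"
| "eval A v (Imp a b) = im A (eval A v a) (eval A v b)"
| "eval A v (Neg a) = ng A (eval A v a)"

definition validates :: "('a, 'b) halg_scheme \<Rightarrow> fm list \<Rightarrow> nat \<Rightarrow> nat \<Rightarrow> bool" where
  "validates A phis y z \<longleftrightarrow>
     (\<forall>v. (\<forall>i. v i \<in> car A) \<longrightarrow>
        (\<forall>f\<in>set phis. ale A (mt A (eval A v f) (v y)) (v z)) \<longrightarrow> ale A (v y) (v z))"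

text \<open>S is the universe of a subalgebra of the L-reduct of H.  The L-subreduct itself is
  H with carrier restricted to S (operations outside L are never used on L-formulas).\<close>
definition subuniverse :: "sym set \<Rightarrow> ('a, 'b) halg_scheme \<Rightarrow> 'a set \<Rightarrow> bool" where
  "subuniverse L H S \<longleftrightarrow> S \<subseteq> car H \<and>
     (SAnd \<in> L \<longrightarrow> (\<forall>a\<in>S. \<forall>b\<in>S. mt H a b \<in> S)) \<and>
     (SOr \<in> L \<longrightarrow> (\<forall>a\<in>S. \<forall>b\<in>S. jn H a b \<in> S)) \<and>
     (SImp \<in> L \<longrightarrow> (\<forall>a\<in>S. \<forall>b\<in>S. im H a b \<in> S)) \<and>
     (SNeg \<in> L \<longrightarrow> (\<forall>a\<in>S. ng H a \<in> S)) \<and>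
     (SBot \<in> L \<longrightarrow> bt H \<in> S) \<and>
     (STop \<in> L \<longrightarrow> tp H \<in> S)"

definition subreduct :: "('a, 'b) halg_scheme \<Rightarrow> 'a set \<Rightarrow> ('a, 'b) halg_scheme" where
  "subreduct H S = H\<lparr>car := S\<rparr>"

definition is_filter :: "('a, 'b) halg_scheme \<Rightarrow> 'a set \<Rightarrow> bool" where
  "is_filter A F \<longleftrightarrow> F \<subseteq> car A \<and> F \<noteq> {} \<and>
     (\<forall>a\<in>F. \<forall>b\<in>car A. ale A a b \<longrightarrow> b \<in> F) \<and>
     (\<forall>a\<in>F. \<forall>b\<in>F. mt A a b \<in> F)"

definition meet_irreducible :: "('a, 'b) halg_scheme \<Rightarrow> 'a set \<Rightarrow> bool" where
  "meet_irreducible A F \<longleftrightarrow> is_filter A F \<and> F \<noteq> car A \<and>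
     \<not> (\<exists>G K. is_filter A G \<and> is_filter A K \<and> G \<noteq> F \<and> K \<noteq> F \<and> F = G \<inter> K)"

text \<open>Underlying set of the poset A_* (ordered by inclusion).\<close>
definition dual_space :: "('a, 'b) halg_scheme \<Rightarrow> 'a set set" where
  "dual_space A = {F. meet_irreducible A F}"

definition up_alg :: "'c set \<Rightarrow> ('c \<Rightarrow> 'c \<Rightarrow> bool) \<Rightarrow> 'c set halg" where
  "up_alg X le =
     (let imp = (\<lambda>U V. X - {x\<in>X. \<exists>u\<in>U - V. le x u}) in
     \<lparr> car = {U. U \<subseteq> X \<and> (\<forall>x\<in>U. \<forall>y\<in>X. le x y \<longrightarrow> y \<in> U)},
       mt = (\<inter>), jn = (\<union>), im = imp, ng = (\<lambda>U. imp U {}),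
       bt = {}, tp = X \<rparr>)"

end

theory Submission
  imports Defs
begin

text \<open>
  Suppose an upset valuation \<open>V\<close> refutes the quasiequation at a point \<open>x\<close> of the dual space, so
  that every \<open>\<phi>\<^sub>i\<close> fails at \<open>x\<close>. These failures are witnessed by a finite set \<open>W\<close> of points above
  \<open>x\<close>, and they survive when \<open>V p\<close> is shrunk to the upset generated by \<open>W \<inter> V p\<close>. They also survive
  when this upset is replaced by the closed upset of all points containing the filter
  \<open>I p = \<Inter>(W \<inter> V p)\<close>: if disjunction or implication is available, meet irreducible filters are
  prime and the two upsets coincide. By compactness (a filter maximal with respect to avoiding an
  updirected set is meet irreducible) the failures are then witnessed by elements \<open>v p \<in> I p\<close> of the
  algebra. Finally, since \<open>x\<close> is meet irreducible and contains none of the values of the \<open>\<phi>\<^sub>i\<close>, some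
  \<open>y \<in> x\<close> and \<open>z \<notin> x\<close> satisfy \<open>\<phi>\<^sub>i \<and> y \<le> z\<close> for all \<open>i\<close>.
\<close>

section \<open>Heyting algebras\<close>

locale heyting =
  fixes H :: "'a halg"
  assumes heyting: "heyting_algebra H"
begin

abbreviation le (infix "\<preceq>" 50) where "a \<preceq> b \<equiv> ale H a b"
abbreviation meet (infixl "\<sqinter>" 70) where "a \<sqinter> b \<equiv> mt H a b"

lemma closed [simp]:
  "bt H \<in> car H" "tp H \<in> car H"
  "a \<in> car H \<Longrightarrow> b \<in> car H \<Longrightarrow> a \<sqinter> b \<in> car H"
  "a \<in> car H \<Longrightarrow> b \<in> car H \<Longrightarrow> jn H a b \<in> car H"
  "a \<in> car H \<Longrightarrow> b \<in> car H \<Longrightarrow> im H a b \<in> car H"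
  "a \<in> car H \<Longrightarrow> ng H a \<in> car H"
  using heyting unfolding heyting_algebra_def by blast+

lemma eval_closed: "(\<And>i. v i \<in> car H) \<Longrightarrow> eval H v f \<in> car H"
  by (induction f) simp_all

lemma meet_commute: "a \<in> car H \<Longrightarrow> b \<in> car H \<Longrightarrow> a \<sqinter> b = b \<sqinter> a"
  and meet_assoc: "a \<in> car H \<Longrightarrow> b \<in> car H \<Longrightarrow> c \<in> car H \<Longrightarrow> a \<sqinter> (b \<sqinter> c) = a \<sqinter> b \<sqinter> c"
  and meet_idem: "a \<in> car H \<Longrightarrow> a \<sqinter> a = a"
  using heyting unfolding heyting_algebra_def by blast+

lemma join_commute: "a \<in> car H \<Longrightarrow> b \<in> car H \<Longrightarrow> jn H a b = jn H b a"
  and join_assoc: "a \<in> car H \<Longrightarrow> b \<in> car H \<Longrightarrow> c \<in> car H \<Longrightarrow> jn H a (jn H b c) = jn H (jn H a b) c"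
  and meet_join_absorb: "a \<in> car H \<Longrightarrow> b \<in> car H \<Longrightarrow> a \<sqinter> jn H a b = a"
  and join_meet_absorb: "a \<in> car H \<Longrightarrow> b \<in> car H \<Longrightarrow> jn H a (a \<sqinter> b) = a"
  using heyting unfolding heyting_algebra_def by blast+

lemma bot_le [simp]: "a \<in> car H \<Longrightarrow> bt H \<preceq> a"
  and le_top [simp]: "a \<in> car H \<Longrightarrow> a \<preceq> tp H"
  and le_im_iff: "a \<in> car H \<Longrightarrow> b \<in> car H \<Longrightarrow> c \<in> car H \<Longrightarrow> c \<preceq> im H a b \<longleftrightarrow> c \<sqinter> a \<preceq> b"
  and ng_eq: "a \<in> car H \<Longrightarrow> ng H a = im H a (bt H)"
  using heyting unfolding heyting_algebra_def by blast+

lemma le_refl [simp]: "a \<in> car H \<Longrightarrow> a \<preceq> a"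
  by (simp add: ale_def meet_idem)

lemma le_trans: "a \<preceq> b \<Longrightarrow> b \<preceq> c \<Longrightarrow> a \<in> car H \<Longrightarrow> b \<in> car H \<Longrightarrow> c \<in> car H \<Longrightarrow> a \<preceq> c"
  unfolding ale_def by (metis meet_assoc)

lemma le_antisym: "a \<preceq> b \<Longrightarrow> b \<preceq> a \<Longrightarrow> a \<in> car H \<Longrightarrow> b \<in> car H \<Longrightarrow> a = b"
  unfolding ale_def by (metis meet_commute)

lemma meet_le2 [simp]: "a \<in> car H \<Longrightarrow> b \<in> car H \<Longrightarrow> a \<sqinter> b \<preceq> b"
  unfolding ale_def by (metis meet_assoc meet_idem)

lemma meet_le1 [simp]: "a \<in> car H \<Longrightarrow> b \<in> car H \<Longrightarrow> a \<sqinter> b \<preceq> a"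
  by (metis meet_commute meet_le2)

lemma le_meetI: "c \<preceq> a \<Longrightarrow> c \<preceq> b \<Longrightarrow> a \<in> car H \<Longrightarrow> b \<in> car H \<Longrightarrow> c \<in> car H \<Longrightarrow> c \<preceq> a \<sqinter> b"
  unfolding ale_def by (metis meet_assoc)

lemma meet_mono:
  "a \<preceq> c \<Longrightarrow> b \<preceq> d \<Longrightarrow> a \<in> car H \<Longrightarrow> b \<in> car H \<Longrightarrow> c \<in> car H \<Longrightarrow> d \<in> car H \<Longrightarrow> a \<sqinter> b \<preceq> c \<sqinter> d"
  using le_trans[of "a \<sqinter> b" a c] le_trans[of "a \<sqinter> b" b d] by (simp add: le_meetI)

lemma meet_le_trans:
  "e \<sqinter> a \<preceq> c \<Longrightarrow> e' \<preceq> e \<Longrightarrow> a' \<preceq> a \<Longrightarrow> e \<in> car H \<Longrightarrow> a \<in> car H \<Longrightarrow> c \<in> car H \<Longrightarrow>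
    e' \<in> car H \<Longrightarrow> a' \<in> car H \<Longrightarrow> e' \<sqinter> a' \<preceq> c"
  using le_trans[of "e' \<sqinter> a'" "e \<sqinter> a" c] by (simp add: meet_mono)

lemma le_join1 [simp]: "a \<in> car H \<Longrightarrow> b \<in> car H \<Longrightarrow> a \<preceq> jn H a b"
  by (simp add: ale_def meet_join_absorb)

lemma le_join2 [simp]: "a \<in> car H \<Longrightarrow> b \<in> car H \<Longrightarrow> b \<preceq> jn H a b"
  by (metis join_commute le_join1)

lemma join_leI:
  assumes "a \<preceq> c" "b \<preceq> c" "a \<in> car H" "b \<in> car H" "c \<in> car H"
  shows "jn H a b \<preceq> c"
proof -
  \<comment> \<open>The order is given through meets; absorption turns it into its join
    form.\<close>
  have absorb: "jn H d c = c" if "d \<preceq> c" "d \<in> car H" for d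
    using that assms(5) unfolding ale_def by (metis join_commute join_meet_absorb meet_commute)
  have "jn H (jn H a b) c = c"
    using assms absorb by (simp flip: join_assoc)
  then show ?thesis
    using assms by (metis closed(4) le_join1)
qed

lemma join_mono:
  "a \<preceq> c \<Longrightarrow> b \<preceq> d \<Longrightarrow> a \<in> car H \<Longrightarrow> b \<in> car H \<Longrightarrow> c \<in> car H \<Longrightarrow> d \<in> car H \<Longrightarrow> jn H a b \<preceq> jn H c d"
  using le_trans[of a c "jn H c d"] le_trans[of b d "jn H c d"] by (simp add: join_leI)

lemma im_meet_le: "a \<in> car H \<Longrightarrow> b \<in> car H \<Longrightarrow> im H a b \<sqinter> a \<preceq> b"
  by (simp flip: le_im_iff)

lemma im_mono:
  assumes "c \<preceq> a" "b \<preceq> d" "a \<in> car H" "b \<in> car H" "c \<in> car H" "d \<in> car H"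
  shows "im H a b \<preceq> im H c d"
proof -
  have "im H a b \<sqinter> c \<preceq> b"
    using assms by (intro meet_le_trans[OF im_meet_le]) simp_all
  then have "im H a b \<sqinter> c \<preceq> d"
    using assms le_trans[of "im H a b \<sqinter> c" b d] by simp
  then show ?thesis
    using assms by (simp add: le_im_iff)
qed

lemma ng_mono: "c \<preceq> a \<Longrightarrow> a \<in> car H \<Longrightarrow> c \<in> car H \<Longrightarrow> ng H a \<preceq> ng H c"
  by (simp add: ng_eq im_mono)

lemma le_ng_iff: "a \<in> car H \<Longrightarrow> c \<in> car H \<Longrightarrow> c \<preceq> ng H a \<longleftrightarrow> c \<sqinter> a \<preceq> bt H"
  by (simp add: ng_eq le_im_iff)

lemma meet_ng: "a \<in> car H \<Longrightarrow> a \<sqinter> ng H a = bt H"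
  by (metis closed(1,3,6) bot_le le_antisym le_ng_iff le_refl meet_commute)

text \<open>Meeting with \<open>e\<close> has the right adjoint \<open>im H e\<close>, so it
  preserves joins. The adjoint is taken in \<open>H\<close>, which makes the result available for
  subreducts whose language lacks implication.\<close>

lemma meet_join_le:
  assumes "e \<sqinter> a \<preceq> c" "e \<sqinter> b \<preceq> c" "a \<in> car H" "b \<in> car H" "c \<in> car H" "e \<in> car H"
  shows "e \<sqinter> jn H a b \<preceq> c"
proof -
  have "a \<preceq> im H e c" "b \<preceq> im H e c"
    using assms by (simp_all add: le_im_iff meet_commute)
  then have "jn H a b \<preceq> im H e c"
    using assms by (simp add: join_leI)
  then show ?thesis
    using assms by (simp add: le_im_iff meet_commute)
qed

text \<open>Both polarities are proved together because \<open>Imp\<close> and \<open>Neg\<close>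
  exchange them.\<close>

lemma eval_mono:
  assumes "\<And>i. v i \<in> car H" "\<And>i. v' i \<in> car H" "\<And>i. v i \<preceq> v' i"
  shows "polar True f \<Longrightarrow> eval H v f \<preceq> eval H v' f"
    and "polar False f \<Longrightarrow> eval H v' f \<preceq> eval H v f"
  by (induction f) (simp_all add: assms eval_closed meet_mono join_mono im_mono ng_mono)

end

lemma eval_cong: "(\<And>i. i \<in> vars f \<Longrightarrow> v i = v' i) \<Longrightarrow> eval A v f = eval A v' f"
  by (induction f) simp_all

section \<open>Filters of a subreduct\<close>

locale heyting_subreduct = heyting +
  fixes L :: "sym set" and S :: "'a set"
  assumes SAnd: "SAnd \<in> L" and subuniverse: "subuniverse L H S"
begin

lemma S_car [simp]: "a \<in> S \<Longrightarrow> a \<in> car H"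
  and S_meet [simp]: "a \<in> S \<Longrightarrow> b \<in> S \<Longrightarrow> a \<sqinter> b \<in> S"
  and S_join: "SOr \<in> L \<Longrightarrow> a \<in> S \<Longrightarrow> b \<in> S \<Longrightarrow> jn H a b \<in> S"
  and S_im: "SImp \<in> L \<Longrightarrow> a \<in> S \<Longrightarrow> b \<in> S \<Longrightarrow> im H a b \<in> S"
  and S_ng: "SNeg \<in> L \<Longrightarrow> a \<in> S \<Longrightarrow> ng H a \<in> S"
  and S_bt: "SBot \<in> L \<Longrightarrow> bt H \<in> S"
  and S_tp: "STop \<in> L \<Longrightarrow> tp H \<in> S"
  using SAnd subuniverse unfolding subuniverse_def by blast+

lemma eval_S: "(\<And>i. v i \<in> S) \<Longrightarrow> syms f \<subseteq> L \<Longrightarrow> eval H v f \<in> S"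
  by (induction f) (simp_all add: S_join S_im S_ng S_bt S_tp)

abbreviation "fil \<equiv> is_filter (subreduct H S)"
abbreviation "X \<equiv> dual_space (subreduct H S)"

lemma ale_subreduct [simp]: "ale (subreduct H S) = ale H"
  by (simp add: fun_eq_iff ale_def subreduct_def)

lemma eval_subreduct [simp]: "eval (subreduct H S) v f = eval H v f"
  by (induction f) (simp_all add: subreduct_def)

lemma fil_iff:
  "fil F \<longleftrightarrow> F \<subseteq> S \<and> F \<noteq> {} \<and> (\<forall>a\<in>F. \<forall>b\<in>S. a \<preceq> b \<longrightarrow> b \<in> F) \<and> (\<forall>a\<in>F. \<forall>b\<in>F. a \<sqinter> b \<in> F)"
  unfolding is_filter_def ale_subreduct by (simp add: subreduct_def)

lemma fil_S: "fil F \<Longrightarrow> a \<in> F \<Longrightarrow> a \<in> S"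
  and fil_up: "fil F \<Longrightarrow> a \<in> F \<Longrightarrow> a \<preceq> b \<Longrightarrow> b \<in> S \<Longrightarrow> b \<in> F"
  and fil_meet: "fil F \<Longrightarrow> a \<in> F \<Longrightarrow> b \<in> F \<Longrightarrow> a \<sqinter> b \<in> F"
  unfolding fil_iff by blast+

lemma X_iff:
  "w \<in> X \<longleftrightarrow> fil w \<and> w \<noteq> S \<and> (\<forall>G K. fil G \<longrightarrow> fil K \<longrightarrow> w = G \<inter> K \<longrightarrow> G = w \<or> K = w)"
  unfolding dual_space_def meet_irreducible_def by (auto simp: subreduct_def)

lemma X_fil [simp]: "w \<in> X \<Longrightarrow> fil w"
  by (simp add: X_iff)

lemma X_Int: "w \<in> X \<Longrightarrow> fil G \<Longrightarrow> fil K \<Longrightarrow> w = G \<inter> K \<Longrightarrow> G = w \<or> K = w"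
  and X_proper: "w \<in> X \<Longrightarrow> w \<noteq> S"
  unfolding X_iff by blast+

lemma meet_in_X_iff: "w \<in> X \<Longrightarrow> a \<in> S \<Longrightarrow> b \<in> S \<Longrightarrow> a \<sqinter> b \<in> w \<longleftrightarrow> a \<in> w \<and> b \<in> w"
  by (meson S_car X_fil fil_meet fil_up meet_le1 meet_le2)

section \<open>Filter extension and meet irreducibility\<close>

definition gen :: "'a set \<Rightarrow> 'a \<Rightarrow> 'a set" where
  "gen F a = {c \<in> S. \<exists>e\<in>F. e \<sqinter> a \<preceq> c}"

lemma gen:
  assumes F: "fil F" and a: "a \<in> S"
  shows fil_gen: "fil (gen F a)" and gen_sub: "F \<subseteq> gen F a" and gen_mem: "a \<in> gen F a"
proof -
  note FS = fil_S[OF F]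
  show sub: "F \<subseteq> gen F a"
    using a FS by (force simp: gen_def)
  show "a \<in> gen F a"
  proof -
    obtain e where "e \<in> F" using F unfolding fil_iff by blast
    then show ?thesis using a FS meet_le2[of e a] S_car unfolding gen_def by blast
  qed
  have up: "d \<in> gen F a" if "c \<in> gen F a" "d \<in> S" "c \<preceq> d" for c d
  proof -
    from that obtain e where e: "e \<in> F" "e \<sqinter> a \<preceq> c" and c: "c \<in> S"
      by (auto simp: gen_def)
    have "e \<sqinter> a \<preceq> d"
      by (rule le_trans[OF e(2) that(3)]) (use that e c a FS in simp_all)
    with e that show ?thesis by (auto simp: gen_def)
  qed
  have meet: "c \<sqinter> d \<in> gen F a" if "c \<in> gen F a" "d \<in> gen F a" for c d
  proof -
    from that obtain e e' where e: "e \<in> F" "e \<sqinter> a \<preceq> c" "e' \<in> F" "e' \<sqinter> a \<preceq> d"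
      and S: "c \<in> S" "d \<in> S"
      by (auto simp: gen_def)
    have "e \<in> car H" "e' \<in> car H" "a \<in> car H" "c \<in> car H" "d \<in> car H"
      using S e a FS by simp_all
    note car = this
    have "e \<sqinter> e' \<sqinter> a \<preceq> c" "e \<sqinter> e' \<sqinter> a \<preceq> d"
      using car by (simp_all add: meet_le_trans[OF e(2)] meet_le_trans[OF e(4)])
    then have "e \<sqinter> e' \<sqinter> a \<preceq> c \<sqinter> d"
      using car by (simp add: le_meetI)
    moreover have "e \<sqinter> e' \<in> F" using fil_meet[OF F] e by blast
    ultimately show ?thesis
      unfolding gen_def using S by auto
  qed
  show "fil (gen F a)"
    unfolding fil_iff using sub F up meet by (auto simp: gen_def fil_iff)
qed

text \<open>The filters \<open>gen w a\<close> and \<open>gen w b\<close> both properly extend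
  \<open>w\<close>, so irreducibility yields some \<open>c\<close> outside \<open>w\<close> in both
  of them; meeting the two witnesses gives a single \<open>e\<close>. This elementwise form stands
  in for primeness when \<open>S\<close> has no joins.\<close>

lemma X_irreducible:
  assumes "w \<in> X" "a \<in> S - w" "b \<in> S - w"
  obtains e c where "e \<in> w" "c \<in> S - w" "e \<sqinter> a \<preceq> c" "e \<sqinter> b \<preceq> c"
proof -
  have fw: "fil w" using assms by simp
  have "w \<noteq> gen w a \<inter> gen w b"
  proof
    assume "w = gen w a \<inter> gen w b"
    then have "gen w a = w \<or> gen w b = w"
      using assms X_Int[OF assms(1) fil_gen[OF fw] fil_gen[OF fw]] by blast
    then show False using gen_mem[OF fw, of a] gen_mem[OF fw, of b] assms by auto
  qed
  then obtain c where c: "c \<in> S" "c \<notin> w" "c \<in> gen w a" "c \<in> gen w b"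
    using gen_sub[OF fw, of a] gen_sub[OF fw, of b] assms(2,3) fil_S[OF fil_gen[OF fw, of a]] by blast
  then obtain e e' where e: "e \<in> w" "e \<sqinter> a \<preceq> c" "e' \<in> w" "e' \<sqinter> b \<preceq> c"
    by (auto simp: gen_def)
  have car: "e \<in> car H" "e' \<in> car H" "a \<in> car H" "b \<in> car H" "c \<in> car H"
    using assms c e fil_S[OF fw] by auto
  have "e \<sqinter> e' \<sqinter> a \<preceq> c" "e \<sqinter> e' \<sqinter> b \<preceq> c"
    using car by (simp_all add: meet_le_trans[OF e(2)] meet_le_trans[OF e(4)])
  moreover have "e \<sqinter> e' \<in> w" using fil_meet[OF fw] e by blast
  ultimately show thesis using c that by blast
qed

text \<open>This supplies the values of the two extra variables \<open>y\<close> and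
  \<open>z\<close> in a refutation. It iterates \<open>X_irreducible\<close> over \<open>B\<close>,
  starting from properness of \<open>w\<close>.\<close>

lemma X_separation:
  assumes w: "w \<in> X" and "finite B" and "B \<subseteq> S - w"
  obtains y0 z0 where "y0 \<in> w" "z0 \<in> S - w" "\<And>b. b \<in> B \<Longrightarrow> b \<sqinter> y0 \<preceq> z0"
proof -
  have fw: "fil w" using w by simp
  from assms(2,3) have "\<exists>y0\<in>w. \<exists>z0\<in>S - w. \<forall>b\<in>B. b \<sqinter> y0 \<preceq> z0"
  proof (induction B)
    case empty
    then show ?case using X_proper[OF w] fw unfolding fil_iff by blast
  next
    case (insert b B)
    then obtain y0 z0 where yz: "y0 \<in> w" "z0 \<in> S - w" "\<forall>b\<in>B. b \<sqinter> y0 \<preceq> z0" by auto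
    \<comment> \<open>Irreducibility applied to \<open>b\<close> and the old bound \<open>z0\<close>
      replaces that bound by one that also works for \<open>b\<close>.\<close>
    obtain e c where e: "e \<in> w" "c \<in> S - w" "e \<sqinter> b \<preceq> c" "e \<sqinter> z0 \<preceq> c"
      using X_irreducible[OF w, of b z0] insert.prems yz by blast
    have car: "e \<in> car H" "c \<in> car H" "y0 \<in> car H" "z0 \<in> car H"
      using e yz fil_S[OF fw] by auto
    have "b' \<sqinter> (e \<sqinter> y0) \<preceq> c" if "b' \<in> insert b B" for b'
    proof -
      have b': "b' \<in> car H" using that insert.prems by auto
      consider "b' = b" | "b' \<in> B" using \<open>b' \<in> insert b B\<close> by blast
      then show ?thesis
      proof cases
        case 1
        have "b \<sqinter> e \<preceq> c"
          using e(3) b' car 1 by (simp add: meet_commute)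
        then show ?thesis
          using b' car 1 by (simp add: meet_le_trans[of b e])
      next
        case 2
        have "b' \<sqinter> (e \<sqinter> y0) = e \<sqinter> (b' \<sqinter> y0)"
          using b' car by (metis closed(3) meet_assoc meet_commute)
        also have "\<dots> \<preceq> c"
          using yz 2 b' car by (simp add: meet_le_trans[OF e(4)])
        finally show ?thesis .
      qed
    qed
    moreover have "e \<sqinter> y0 \<in> w" using fil_meet[OF fw] e yz by blast
    ultimately show ?case using e by blast
  qed
  then show thesis using that by blast
qed

text \<open>Zorn's lemma gives a filter maximal among those that contain \<open>G\<close> and avoid
  \<open>D\<close>. If it were the intersection of two other filters, each would meet
  \<open>D\<close>, and directedness would put a common element of \<open>D\<close> into both. The
  last conclusion is maximality expressed by elements.\<close>

lemma X_extension:
  assumes G: "fil G" and D: "D \<noteq> {}" "D \<subseteq> S" "G \<inter> D = {}"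
    and dir: "\<And>c d. c \<in> D \<Longrightarrow> d \<in> D \<Longrightarrow> \<exists>e\<in>D. c \<preceq> e \<and> d \<preceq> e"
  obtains u where "u \<in> X" "G \<subseteq> u" "u \<inter> D = {}"
    "\<And>a. a \<in> S - u \<Longrightarrow> \<exists>e\<in>u. \<exists>d\<in>D. e \<sqinter> a \<preceq> d"
proof -
  let ?A = "{F. fil F \<and> G \<subseteq> F \<and> F \<inter> D = {}}"
  have "\<exists>M\<in>?A. \<forall>F\<in>?A. M \<subseteq> F \<longrightarrow> F = M"
  proof (rule subset_Zorn_nonempty)
    show "?A \<noteq> {}" using G D by blast
  next
    fix C assume C: "C \<noteq> {}" "subset.chain ?A C"
    note chain = C(2)[unfolded subset_chain_def]
    have CA: "C \<subseteq> ?A" using chain by (rule conjunct1)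
    have lin: "F \<subseteq> F' \<or> F' \<subseteq> F" if "F \<in> C" "F' \<in> C" for F F'
      using chain[THEN conjunct2] that by blast
    have CF: "fil F" if "F \<in> C" for F using CA that by blast
    have up: "b \<in> \<Union>C" if "a \<in> \<Union>C" "b \<in> S" "a \<preceq> b" for a b
      using that fil_up[OF CF] by blast
    have meet: "a \<sqinter> b \<in> \<Union>C" if "a \<in> \<Union>C" "b \<in> \<Union>C" for a b
    proof -
      from that obtain F F' where "F \<in> C" "F' \<in> C" "a \<in> F" "b \<in> F'" by blast
      with lin obtain F where "F \<in> C" "a \<in> F" "b \<in> F" by blast
      then show ?thesis using fil_meet[OF CF] by blast
    qed
    have "\<Union>C \<subseteq> S" using fil_S[OF CF] by blast
    moreover have "\<Union>C \<noteq> {}" using C(1) CF unfolding fil_iff by blast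
    ultimately have "fil (\<Union>C)"
      unfolding fil_iff using up meet by blast
    then show "\<Union>C \<in> ?A" using C(1) CA by blast
  qed
  then obtain u where "u \<in> ?A" and maxA: "\<forall>F\<in>?A. u \<subseteq> F \<longrightarrow> F = u" ..
  then have u: "fil u" "G \<subseteq> u" "u \<inter> D = {}" by simp_all
  have max: "F = u" if "fil F" "u \<subseteq> F" "F \<inter> D = {}" for F
    using maxA that u(2) by simp
  have "u \<in> X"
  proof -
    have "G = u \<or> K = u" if GK: "fil G" "fil K" "u = G \<inter> K" for G K
    proof (rule ccontr)
      assume "\<not> ?thesis"
      moreover have "u \<subseteq> G" "u \<subseteq> K" using GK(3) by auto
      ultimately have "G \<inter> D \<noteq> {}" "K \<inter> D \<noteq> {}"
        using max[OF GK(1)] max[OF GK(2)] by auto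
      then obtain c d where cd: "c \<in> G" "c \<in> D" "d \<in> K" "d \<in> D" by blast
      with dir obtain e where e: "e \<in> D" "c \<preceq> e" "d \<preceq> e" by blast
      then have "e \<in> G" "e \<in> K"
        using cd fil_up[OF GK(1)] fil_up[OF GK(2)] D(2) by blast+
      then show False using e u(3) GK(3) by blast
    qed
    moreover have "u \<noteq> S" using u(3) D(1,2) by blast
    ultimately show ?thesis using u(1) unfolding X_iff by blast
  qed
  moreover have "\<exists>e\<in>u. \<exists>d\<in>D. e \<sqinter> a \<preceq> d" if "a \<in> S - u" for a
  proof -
    \<comment> \<open>This filter properly extends \<open>u\<close>, so by maximality it cannot
      avoid \<open>D\<close>.\<close>
    have "gen u a \<inter> D \<noteq> {}"
      using max[OF fil_gen[OF u(1)]] gen_sub[OF u(1)] gen_mem[OF u(1)] that by blast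
    then show ?thesis by (auto simp: gen_def)
  qed
  ultimately show thesis using that u by blast
qed

text \<open>If primeness failed, \<open>X_irreducible\<close> would give \<open>e\<close> in
  \<open>w\<close> and a common bound \<open>c\<close> outside \<open>w\<close>; distributivity of
  \<open>H\<close> would then put \<open>c\<close> into \<open>w\<close>.\<close>

lemma join_in_X_iff:
  assumes "SOr \<in> L" "w \<in> X" "a \<in> S" "b \<in> S"
  shows "jn H a b \<in> w \<longleftrightarrow> a \<in> w \<or> b \<in> w"
proof
  assume j: "jn H a b \<in> w"
  show "a \<in> w \<or> b \<in> w"
  proof (rule ccontr)
    assume "\<not> ?thesis"
    then obtain e c where e: "e \<in> w" "c \<in> S - w" "e \<sqinter> a \<preceq> c" "e \<sqinter> b \<preceq> c"
      using X_irreducible[of w a b] assms by blast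
    then have "e \<sqinter> jn H a b \<preceq> c"
      using assms fil_S[OF X_fil] by (intro meet_join_le) auto
    then show False
      using e j assms fil_meet fil_up X_fil by (metis DiffD1 DiffD2)
  qed
next
  assume "a \<in> w \<or> b \<in> w"
  then show "jn H a b \<in> w"
    using assms fil_up[OF X_fil] S_join by (meson S_car le_join1 le_join2)
qed

lemma im_in_X_mp:
  assumes "w \<in> X" "im H a b \<in> w" "a \<in> w" "b \<in> S"
  shows "b \<in> w"
  using assms by (meson S_car X_fil fil_S fil_meet fil_up im_meet_le)

lemma bot_notin_X:
  assumes w: "w \<in> X" shows "bt H \<notin> w"
proof
  assume "bt H \<in> w"
  then have "S \<subseteq> w" using fil_up[OF X_fil[OF w]] bot_le S_car by blast
  then show False using X_proper[OF w] fil_S[OF X_fil[OF w]] by blast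
qed

lemma ng_in_X_contr: "w \<in> X \<Longrightarrow> ng H a \<in> w \<Longrightarrow> a \<in> w \<Longrightarrow> False"
  by (metis S_car X_fil bot_notin_X fil_S fil_meet meet_ng)

lemma top_in_X: "w \<in> X \<Longrightarrow> tp H \<in> S \<Longrightarrow> tp H \<in> w"
  using fil_up[OF X_fil] fil_S[OF X_fil] fil_iff[of w] by (meson S_car X_fil all_not_in_conv le_top)

text \<open>The meet of \<open>a\<close> and \<open>ng H a\<close> is 0, so 0 is an element of
  \<open>S\<close> even if its symbol is missing from \<open>L\<close>.\<close>

lemma S_bot_if_ng:
  assumes "SNeg \<in> L" "a \<in> S" shows "bt H \<in> S"
  by (metis S_car S_meet S_ng assms meet_ng)

text \<open>With \<open>D = {bt H}\<close>, \<open>X_extension\<close> yields a maximal proper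
  filter, and residuation turns its maximality clause into membership of negations.\<close>

lemma X_maximal_extension:
  assumes "SNeg \<in> L" "w \<in> X"
  obtains m where "m \<in> X" "w \<subseteq> m" "\<And>a. a \<in> S - m \<Longrightarrow> ng H a \<in> m"
proof -
  obtain a where "a \<in> w" using X_fil[OF assms(2)] unfolding fil_iff by blast
  then have bS: "bt H \<in> S" using S_bot_if_ng assms fil_S X_fil by blast
  obtain m where m: "m \<in> X" "w \<subseteq> m"
    and max: "\<And>a. a \<in> S - m \<Longrightarrow> \<exists>e\<in>m. \<exists>d\<in>{bt H}. e \<sqinter> a \<preceq> d"
    by (rule X_extension[of w "{bt H}"]) (use assms bS bot_notin_X in auto)
  have "ng H a \<in> m" if a: "a \<in> S - m" for a
  proof -
    obtain e where e: "e \<in> m" "e \<sqinter> a \<preceq> bt H" using max[OF a] by blast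
    then have "e \<preceq> ng H a" using a fil_S[OF X_fil[OF m(1)]] by (simp add: le_ng_iff)
    then show ?thesis using e a fil_up[OF X_fil[OF m(1)]] S_ng[OF assms(1)] by blast
  qed
  with m show thesis using that by blast
qed

section \<open>The algebra of upsets\<close>

abbreviation "U \<equiv> up_alg X (\<subseteq>)"

text \<open>The operations take the form of Kripke forcing clauses. Since \<open>u\<close> is not
  confined to \<open>X\<close> here, later proofs place witnesses in \<open>X\<close> by
  \<open>eval_U_X\<close>.\<close>

lemma U_simps [simp]:
  "mt U A B = A \<inter> B"
  "jn U A B = A \<union> B"
  "bt U = {}"
  "tp U = X"
  "im U A B = {w \<in> X. \<forall>u. w \<subseteq> u \<longrightarrow> u \<in> A \<longrightarrow> u \<in> B}"
  "ng U A = {w \<in> X. \<forall>u. w \<subseteq> u \<longrightarrow> u \<notin> A}"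
  by (auto simp: up_alg_def Let_def)

definition upval :: "(nat \<Rightarrow> 'a set set) \<Rightarrow> bool" where
  "upval V \<longleftrightarrow> (\<forall>i. V i \<in> car U)"

lemma upval_iff: "upval V \<longleftrightarrow> (\<forall>i. V i \<subseteq> X \<and> (\<forall>w\<in>V i. \<forall>u\<in>X. w \<subseteq> u \<longrightarrow> u \<in> V i))"
  by (simp add: upval_def up_alg_def Let_def)

lemma upval_sub: "upval V \<Longrightarrow> V i \<subseteq> X"
  by (simp add: upval_iff)

lemma eval_U_X: "upval V \<Longrightarrow> w \<in> eval U V f \<Longrightarrow> w \<in> X"
  by (induction f) (auto simp: upval_iff)

lemma eval_U_persistent:
  assumes "upval V"
  shows "w \<in> eval U V f \<Longrightarrow> u \<in> X \<Longrightarrow> w \<subseteq> u \<Longrightarrow> u \<in> eval U V f"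
proof (induction f)
  case (Var n)
  then show ?case using assms unfolding upval_iff by auto
qed (use assms in auto)

lemma eval_U_mono:
  assumes "upval V" "upval V'" "\<And>i. V i \<subseteq> V' i"
  shows "polar True f \<Longrightarrow> eval U V f \<subseteq> eval U V' f"
    and "polar False f \<Longrightarrow> eval U V' f \<subseteq> eval U V f"
  by (induction f) (use assms in auto)

text \<open>Shrinking the valuation while keeping \<open>w\<close> wherever it was leaves the
  variables true at \<open>w\<close> and can only enlarge the values of negative formulas;
  conjunction and disjunction inherit this.\<close>

lemma sahl_ant_witness:
  assumes "upval V" "upval V'" "\<And>i. V' i \<subseteq> V i" "\<And>i. w \<in> V i \<Longrightarrow> w \<in> V' i"
  shows "sahl_ant f \<Longrightarrow> w \<in> eval U V f \<Longrightarrow> w \<in> eval U V' f"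
proof (induction f rule: sahl_ant.induct)
  case (sa_neg f)
  then show ?case using eval_U_mono(2)[OF assms(2,1,3), of f] by (auto simp: negative_def)
qed (use assms in auto)

text \<open>A failing implication or negation is witnessed by one point \<open>w\<close> above
  \<open>x\<close>: keeping \<open>w\<close> preserves the antecedent, and shrinking preserves the
  failure of a positive consequent. Positive formulas need no witness, a conjunction uses the
  witnesses of a failing conjunct, and a disjunction unites those of both disjuncts.\<close>

lemma sahl_comb_witnesses:
  assumes V: "upval V" and x: "x \<in> X"
  shows "sahl_comb f \<Longrightarrow> x \<notin> eval U V f \<Longrightarrow>
    \<exists>W. finite W \<and> W \<subseteq> {w \<in> X. x \<subseteq> w} \<and>
      (\<forall>V'. upval V' \<longrightarrow> (\<forall>i. V' i \<subseteq> V i \<and> W \<inter> V i \<subseteq> V' i) \<longrightarrow> x \<notin> eval U V' f)"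
proof (induction f rule: sahl_comb.induct)
  case (sc_imp f)
  consider "positive f" | a where "f = Neg a" "sahl_ant a"
    | a b where "f = Imp a b" "sahl_ant a" "positive b"
    using sc_imp(1) unfolding sahl_imp_def by blast
  then show ?case
  proof cases
    case 1
    then show ?thesis
      using sc_imp(2) eval_U_mono(1)[OF _ V, of _ f] by (intro exI[of _ "{}"]) (auto simp: positive_def)
  next
    case (2 a)
    then obtain w where w: "w \<in> X" "x \<subseteq> w" "w \<in> eval U V a"
      using sc_imp(2) V x by (auto intro: eval_U_X)
    have "x \<notin> eval U V' f" if "upval V'" "\<forall>i. V' i \<subseteq> V i \<and> {w} \<inter> V i \<subseteq> V' i" for V'
      using sahl_ant_witness[OF V that(1), of w a] that 2 w by (auto intro: eval_U_X)
    then show ?thesis using w by (intro exI[of _ "{w}"]) auto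
  next
    case (3 a b)
    then obtain w where w: "w \<in> X" "x \<subseteq> w" "w \<in> eval U V a" "w \<notin> eval U V b"
      using sc_imp(2) V x by (auto intro: eval_U_X)
    have "x \<notin> eval U V' f" if V': "upval V'" "\<forall>i. V' i \<subseteq> V i \<and> {w} \<inter> V i \<subseteq> V' i" for V'
    proof -
      have "w \<in> eval U V' a" using sahl_ant_witness[OF V V'(1), of w a] V' 3 w by auto
      moreover have "w \<notin> eval U V' b"
        using eval_U_mono(1)[OF V'(1) V, of b] V' 3 w by (auto simp: positive_def)
      ultimately show ?thesis using 3 w V' by (auto intro: eval_U_X)
    qed
    then show ?thesis using w by (intro exI[of _ "{w}"]) auto
  qed
next
  case (sc_and a b)
  have "x \<notin> eval U V a \<or> x \<notin> eval U V b"
    using sc_and.prems V by (auto intro: eval_U_X)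
  then obtain W where "finite W" "W \<subseteq> {w \<in> X. x \<subseteq> w}"
    "\<And>V'. upval V' \<Longrightarrow> (\<forall>i. V' i \<subseteq> V i \<and> W \<inter> V i \<subseteq> V' i) \<Longrightarrow> x \<notin> eval U V' a \<or> x \<notin> eval U V' b"
    using sc_and.IH by meson
  then show ?case by (intro exI[of _ W]) (auto intro: eval_U_X)
next
  case (sc_or a b)
  then obtain Wa Wb where
    "finite Wa" "Wa \<subseteq> {w \<in> X. x \<subseteq> w}"
    "\<And>V'. upval V' \<Longrightarrow> (\<forall>i. V' i \<subseteq> V i \<and> Wa \<inter> V i \<subseteq> V' i) \<Longrightarrow> x \<notin> eval U V' a" and
    "finite Wb" "Wb \<subseteq> {w \<in> X. x \<subseteq> w}"
    "\<And>V'. upval V' \<Longrightarrow> (\<forall>i. V' i \<subseteq> V i \<and> Wb \<inter> V i \<subseteq> V' i) \<Longrightarrow> x \<notin> eval U V' b"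
    using V by (auto intro: eval_U_X)
  moreover from this have
    "upval V' \<Longrightarrow> (\<forall>i. V' i \<subseteq> V i \<and> (Wa \<union> Wb) \<inter> V i \<subseteq> V' i) \<Longrightarrow> x \<notin> eval U V' (Or a b)" for V'
    by (simp add: Int_Un_distrib2)
  ultimately show ?case by (intro exI[of _ "Wa \<union> Wb"]) auto
qed

lemma sahl_combs_witnesses:
  assumes V: "upval V" and x: "x \<in> X" and "finite \<Phi>"
    and "\<And>f. f \<in> \<Phi> \<Longrightarrow> sahl_comb f" "\<And>f. f \<in> \<Phi> \<Longrightarrow> x \<notin> eval U V f"
  obtains W where "finite W" "W \<subseteq> {w \<in> X. x \<subseteq> w}"
    "\<forall>V'. upval V' \<longrightarrow> (\<forall>i. V' i \<subseteq> V i \<and> W \<inter> V i \<subseteq> V' i) \<longrightarrow> (\<forall>f\<in>\<Phi>. x \<notin> eval U V' f)"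
proof -
  have "\<forall>f\<in>\<Phi>. \<exists>W. finite W \<and> W \<subseteq> {w \<in> X. x \<subseteq> w} \<and>
      (\<forall>V'. upval V' \<longrightarrow> (\<forall>i. V' i \<subseteq> V i \<and> W \<inter> V i \<subseteq> V' i) \<longrightarrow> x \<notin> eval U V' f)"
    using sahl_comb_witnesses[OF V x assms(4,5)] by (rule ballI)
  from bchoice[OF this] obtain W where
    "\<forall>f\<in>\<Phi>. finite (W f) \<and> W f \<subseteq> {w \<in> X. x \<subseteq> w} \<and>
      (\<forall>V'. upval V' \<longrightarrow> (\<forall>i. V' i \<subseteq> V i \<and> W f \<inter> V i \<subseteq> V' i) \<longrightarrow> x \<notin> eval U V' f)" ..
  then have W: "\<And>f. f \<in> \<Phi> \<Longrightarrow> finite (W f)" "\<And>f. f \<in> \<Phi> \<Longrightarrow> W f \<subseteq> {w \<in> X. x \<subseteq> w}"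
    "\<And>f V'. f \<in> \<Phi> \<Longrightarrow> upval V' \<Longrightarrow> (\<forall>i. V' i \<subseteq> V i \<and> W f \<inter> V i \<subseteq> V' i) \<Longrightarrow> x \<notin> eval U V' f"
    by simp_all
  show thesis
  proof (rule that[of "\<Union>(W ` \<Phi>)"])
    show "finite (\<Union>(W ` \<Phi>))" "\<Union>(W ` \<Phi>) \<subseteq> {w \<in> X. x \<subseteq> w}" using W assms(3) by auto
  next
    show "\<forall>V'. upval V' \<longrightarrow> (\<forall>i. V' i \<subseteq> V i \<and> \<Union>(W ` \<Phi>) \<inter> V i \<subseteq> V' i) \<longrightarrow> (\<forall>f\<in>\<Phi>. x \<notin> eval U V' f)"
    proof (intro allI impI ballI)
      fix V' f
      assume V': "upval V'" "\<forall>i. V' i \<subseteq> V i \<and> \<Union>(W ` \<Phi>) \<inter> V i \<subseteq> V' i" and f: "f \<in> \<Phi>"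
      have "V' i \<subseteq> V i \<and> W f \<inter> V i \<subseteq> V' i" for i using V'(2)[THEN spec, of i] f by blast
      then show "x \<notin> eval U V' f" using W(3)[OF f V'(1)] by blast
    qed
  qed
qed

section \<open>Closed valuations\<close>

text \<open>If \<open>I p\<close> is the principal filter of \<open>a\<close>, this is the canonical
  image of \<open>a\<close>. In general it is the intersection of the images of all elements of
  \<open>I p\<close>.\<close>

definition closed_val :: "(nat \<Rightarrow> 'a set) \<Rightarrow> nat \<Rightarrow> 'a set set" where
  "closed_val I p = {u \<in> X. I p \<subseteq> u}"

lemma upval_closed_val: "upval (closed_val I)"
  unfolding upval_iff closed_val_def by blast

text \<open>Choosing elements of the filters turns a closed valuation into valuations in the
  algebra. The image of \<open>v p\<close> contains \<open>closed_val I p\<close>, and smaller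
  choices approximate it more closely.\<close>

definition selections :: "(nat \<Rightarrow> 'a set) \<Rightarrow> (nat \<Rightarrow> 'a) set" where
  "selections I = {v. \<forall>p. v p \<in> I p}"

section \<open>Approximation of closed valuations by selections\<close>

context
  fixes I :: "nat \<Rightarrow> 'a set"
  assumes I: "\<And>p. fil (I p)"
begin

lemma selections_S: "v \<in> selections I \<Longrightarrow> v p \<in> S"
  using I fil_S unfolding selections_def by blast

lemma selections_eval_S: "v \<in> selections I \<Longrightarrow> syms f \<subseteq> L \<Longrightarrow> eval H v f \<in> S"
  by (simp add: eval_S selections_S)

lemma selections_nonempty: "selections I \<noteq> {}"
proof -
  have "\<forall>p. \<exists>a. a \<in> I p" using I unfolding fil_iff by blast
  then have "\<exists>v. \<forall>p. v p \<in> I p" by (rule choice)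
  then show ?thesis unfolding selections_def by blast
qed

lemma selections_directed:
  assumes v: "v \<in> selections I" and v': "v' \<in> selections I"
  obtains v'' where "v'' \<in> selections I" "\<And>p. v'' p \<preceq> v p" "\<And>p. v'' p \<preceq> v' p"
proof
  show "(\<lambda>p. v p \<sqinter> v' p) \<in> selections I"
    using v v' I fil_meet unfolding selections_def by blast
  show "v p \<sqinter> v' p \<preceq> v p" "v p \<sqinter> v' p \<preceq> v' p" for p
    using v v' by (simp_all add: selections_S)
qed

lemma selections_mono:
  assumes "v \<in> selections I" "v' \<in> selections I" "\<And>p. v' p \<preceq> v p"
  shows "polar True f \<Longrightarrow> eval H v' f \<preceq> eval H v f"
    and "polar False f \<Longrightarrow> eval H v f \<preceq> eval H v' f"
  using eval_mono[of v' v f] assms by (simp_all add: selections_S)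

text \<open>Successful approximations survive the passage to smaller selections, so several of them
  can be combined by \<open>selections_directed\<close>.\<close>

lemma selections_mono_mem:
  assumes "v \<in> selections I" "v' \<in> selections I" "\<And>p. v' p \<preceq> v p" "w \<in> X" "syms f \<subseteq> L"
  shows "polar True f \<Longrightarrow> eval H v f \<notin> w \<Longrightarrow> eval H v' f \<notin> w"
    and "polar False f \<Longrightarrow> eval H v f \<in> w \<Longrightarrow> eval H v' f \<in> w"
  using selections_mono[OF assms(1,2,3), of f] fil_up[OF X_fil[OF assms(4)]]
    selections_eval_S[OF _ assms(5)] assms(1,2) by blast+

text \<open>As \<open>f\<close> is positive, smaller selections give smaller values and hence larger
  filters \<open>gen w (eval H v f)\<close>. The union of these filters is directed, so it is a
  filter; it avoids \<open>D\<close> by \<open>disj\<close>, and \<open>X_extension\<close> applies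
  to it.\<close>

lemma selections_compact:
  assumes f: "polar True f" "syms f \<subseteq> L" and w: "w \<in> X"
    and D: "D \<noteq> {}" "D \<subseteq> S" "\<And>c d. c \<in> D \<Longrightarrow> d \<in> D \<Longrightarrow> \<exists>e\<in>D. c \<preceq> e \<and> d \<preceq> e"
    and disj: "\<And>e v d. e \<in> w \<Longrightarrow> v \<in> selections I \<Longrightarrow> d \<in> D \<Longrightarrow> \<not> e \<sqinter> eval H v f \<preceq> d"
  obtains u where "u \<in> X" "w \<subseteq> u" "u \<inter> D = {}" "\<forall>v\<in>selections I. eval H v f \<in> u"
proof -
  define G where "G = {c \<in> S. \<exists>v\<in>selections I. c \<in> gen w (eval H v f)}"
  have fw: "fil w" using w by simp
  note fS = selections_eval_S[OF _ f(2)]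
  note fg = fil_gen[OF fw fS]
  have wG: "w \<subseteq> G"
    using selections_nonempty gen_sub[OF fw fS] fil_S[OF fw] unfolding G_def by blast
  have up: "b \<in> G" if "a \<in> G" "b \<in> S" "a \<preceq> b" for a b
    using that fil_up[OF fg] unfolding G_def by blast
  have meet: "a \<sqinter> b \<in> G" if "a \<in> G" "b \<in> G" for a b
  proof -
    from that obtain v v' where v: "v \<in> selections I" "a \<in> gen w (eval H v f)" "a \<in> S"
      and v': "v' \<in> selections I" "b \<in> gen w (eval H v' f)" "b \<in> S"
      unfolding G_def by blast
    obtain v'' where v'': "v'' \<in> selections I" "\<And>p. v'' p \<preceq> v p" "\<And>p. v'' p \<preceq> v' p"
      using selections_directed[OF v(1) v'(1)] by blast
    have "c \<in> gen w (eval H v'' f)"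
      if c: "c \<in> gen w (eval H u f)" "u \<in> selections I" "\<And>p. v'' p \<preceq> u p" for c u
    proof -
      obtain e where e: "e \<in> w" "e \<sqinter> eval H u f \<preceq> c" "c \<in> S" using c unfolding gen_def by blast
      have "e \<in> car H" using e fil_S[OF fw] by simp
      moreover have "eval H v'' f \<preceq> eval H u f"
        using selections_mono(1)[OF c(2) v''(1) c(3) f(1)] .
      moreover have "eval H v'' f \<in> car H" "eval H u f \<in> car H" using fS v''(1) c(2) by auto
      ultimately have "e \<sqinter> eval H v'' f \<preceq> c"
        using e by (simp add: meet_le_trans[OF e(2)])
      then show ?thesis using e unfolding gen_def by blast
    qed
    then have "a \<in> gen w (eval H v'' f)" "b \<in> gen w (eval H v'' f)" using v v' v'' by blast+
    then show ?thesis using fil_meet[OF fg] v v' v''(1) unfolding G_def by auto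
  qed
  have "fil G"
    unfolding fil_iff using up meet wG fw by (auto simp: G_def fil_iff)
  moreover have "G \<inter> D = {}" using disj unfolding G_def gen_def by blast
  ultimately obtain u where "u \<in> X" "G \<subseteq> u" "u \<inter> D = {}"
    using X_extension[OF _ D(1,2) _ D(3)] by metis
  moreover have "eval H v f \<in> G" if "v \<in> selections I" for v
    using gen_mem[OF fw fS[OF that]] fS[OF that] that unfolding G_def by blast
  ultimately show thesis using that wG by blast
qed

text \<open>An intuitionistic Esakia lemma. The negative implication is the only case that needs
  compactness, and negation is its special case with consequent \<open>0\<close>.\<close>

lemma closed_val_approx:
  "syms f \<subseteq> L \<Longrightarrow> w \<in> X \<Longrightarrow> polar True f \<Longrightarrow> w \<notin> eval U (closed_val I) f \<Longrightarrow>
    \<exists>v\<in>selections I. eval H v f \<notin> w"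
  "syms f \<subseteq> L \<Longrightarrow> w \<in> X \<Longrightarrow> polar False f \<Longrightarrow> w \<in> eval U (closed_val I) f \<Longrightarrow>
    \<exists>v\<in>selections I. eval H v f \<in> w"
proof (induction f arbitrary: w)
  case (Var p)
  {
    case 1
    then obtain a where a: "a \<in> I p" "a \<notin> w" by (auto simp: closed_val_def)
    obtain v where "v \<in> selections I" using selections_nonempty by blast
    with a have "v(p := a) \<in> selections I" by (auto simp: selections_def)
    with a show ?case by (intro bexI[of _ "v(p := a)"]) simp_all
  next
    case 2
    then show ?case by simp
  }
next
  case Bot
  {
    case 1
    then show ?case using selections_nonempty bot_notin_X by auto
  next
    case 2
    then show ?case by simp
  }
next
  case Top
  {
    case 1
    then show ?case by simp
  next
    case 2
    then show ?case using selections_nonempty top_in_X S_tp by auto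
  }
next
  case (And f g)
  {
    case 1
    then have "(\<exists>v\<in>selections I. eval H v f \<notin> w) \<or> (\<exists>v\<in>selections I. eval H v g \<notin> w)"
      using And.IH(1,3)[of w] by (auto intro: eval_U_X[OF upval_closed_val])
    then show ?case using 1 meet_in_X_iff[OF \<open>w \<in> X\<close>] selections_eval_S by fastforce
  next
    case 2
    then obtain v v' where v: "v \<in> selections I" "eval H v f \<in> w" "v' \<in> selections I" "eval H v' g \<in> w"
      using And.IH(2,4)[of w] by (auto intro: eval_U_X[OF upval_closed_val])
    \<comment> \<open>The two conjuncts may need different selections; a common lower bound serves
      both.\<close>
    obtain v'' where "v'' \<in> selections I" "\<And>p. v'' p \<preceq> v p" "\<And>p. v'' p \<preceq> v' p"
      using selections_directed[OF v(1,3)] by blast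
    then have "v'' \<in> selections I" "eval H v'' f \<in> w" "eval H v'' g \<in> w"
      using selections_mono_mem(2) v 2 by auto
    then show ?case using fil_meet[OF X_fil[OF \<open>w \<in> X\<close>]] by auto
  }
next
  case (Or f g)
  {
    case 1
    then obtain v v' where v: "v \<in> selections I" "eval H v f \<notin> w" "v' \<in> selections I" "eval H v' g \<notin> w"
      using Or.IH(1,3)[of w] by (auto intro: eval_U_X[OF upval_closed_val])
    obtain v'' where "v'' \<in> selections I" "\<And>p. v'' p \<preceq> v p" "\<And>p. v'' p \<preceq> v' p"
      using selections_directed[OF v(1,3)] by blast
    then have "v'' \<in> selections I" "eval H v'' f \<notin> w" "eval H v'' g \<notin> w"
      using selections_mono_mem(1) v 1 by auto
    then show ?case using 1 join_in_X_iff selections_eval_S by fastforce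
  next
    case 2
    then have "(\<exists>v\<in>selections I. eval H v f \<in> w) \<or> (\<exists>v\<in>selections I. eval H v g \<in> w)"
      using Or.IH(2,4)[of w] by (auto intro: eval_U_X[OF upval_closed_val])
    then show ?case using 2 join_in_X_iff selections_eval_S by fastforce
  }
next
  case (Imp f g)
  {
    case 1
    then obtain u where u: "u \<in> X" "w \<subseteq> u" "u \<in> eval U (closed_val I) f" "u \<notin> eval U (closed_val I) g"
      by (auto intro: eval_U_X[OF upval_closed_val])
    then obtain v v' where v: "v \<in> selections I" "eval H v f \<in> u" "v' \<in> selections I" "eval H v' g \<notin> u"
      using Imp.IH(2,3)[of u] 1 by auto
    obtain v'' where v'': "v'' \<in> selections I" "\<And>p. v'' p \<preceq> v p" "\<And>p. v'' p \<preceq> v' p"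
      using selections_directed[OF v(1,3)] by blast
    \<comment> \<open>Presence of the antecedent in \<open>u\<close> and absence of the consequent
      both survive at \<open>v''\<close>. Modus ponens then excludes the implication from
      \<open>u\<close>, hence from \<open>w\<close>.\<close>
    have "eval H v'' f \<in> u"
      by (rule selections_mono_mem(2)[OF v(1) v''(1,2) u(1) _ _ v(2)]) (use 1 in auto)
    moreover have "eval H v'' g \<notin> u"
      by (rule selections_mono_mem(1)[OF v(3) v''(1,3) u(1) _ _ v(4)]) (use 1 in auto)
    ultimately have "eval H v'' (Imp f g) \<notin> w"
      using im_in_X_mp[OF u(1)] u(2) 1 v''(1) selections_eval_S by auto
    then show ?case using v'' by blast
  next
    case 2
    have L: "syms f \<subseteq> L" "syms g \<subseteq> L" "SImp \<in> L" and pol: "polar True f" "polar False g"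
      using 2 by auto
    show ?case
    proof (rule ccontr)
      assume neg: "\<not> ?case"
      \<comment> \<open>As \<open>g\<close> is negative, its values grow when selections shrink, so
        this set is updirected. The extended filter is to avoid it.\<close>
      let ?D = "{eval H v g |v. v \<in> selections I}"
      \<comment> \<open>An inequality between values at different selections passes to a common
        lower one, since \<open>f\<close> is positive and \<open>g\<close> negative; residuation
        would then put a value of \<open>Imp f g\<close> into \<open>w\<close>.\<close>
      have disj: "\<not> e \<sqinter> eval H v f \<preceq> d" if d: "e \<in> w" "v \<in> selections I" "d \<in> ?D" for e v d
      proof
        assume le: "e \<sqinter> eval H v f \<preceq> d"
        obtain v' where v': "v' \<in> selections I" "d = eval H v' g" using d by blast
        obtain v'' where v'': "v'' \<in> selections I" "\<And>p. v'' p \<preceq> v p" "\<And>p. v'' p \<preceq> v' p"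
          using selections_directed[OF d(2) v'(1)] by blast
        have "eval H v'' f \<preceq> eval H v f" "eval H v' g \<preceq> eval H v'' g"
          using selections_mono(1)[OF d(2) v''(1,2) pol(1)] selections_mono(2)[OF v'(1) v''(1,3) pol(2)] .
        moreover have car: "e \<in> car H" "eval H v f \<in> car H" "eval H v'' f \<in> car H"
          "eval H v' g \<in> car H" "eval H v'' g \<in> car H"
          using d v' v'' L fil_S[OF X_fil[OF 2(2)]] selections_eval_S by auto
        ultimately have "im H (eval H v f) (eval H v' g) \<preceq> im H (eval H v'' f) (eval H v'' g)"
          by (simp add: im_mono)
        moreover have "e \<preceq> im H (eval H v f) (eval H v' g)"
          using le v' car by (simp add: le_im_iff)
        ultimately have "e \<preceq> eval H v'' (Imp f g)"
          using car le_trans[of e "im H (eval H v f) (eval H v' g)"] by simp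
        then have "eval H v'' (Imp f g) \<in> w"
          using fil_up[OF X_fil[OF 2(2)]] d(1) v''(1) 2(1) selections_eval_S by blast
        then show False using neg v''(1) by blast
      qed
      have dir: "\<exists>e\<in>?D. c \<preceq> e \<and> d \<preceq> e" if cd: "c \<in> ?D" "d \<in> ?D" for c d
      proof -
        from cd obtain v v' where v: "v \<in> selections I" "c = eval H v g" "v' \<in> selections I" "d = eval H v' g"
          by blast
        obtain v'' where v'': "v'' \<in> selections I" "\<And>p. v'' p \<preceq> v p" "\<And>p. v'' p \<preceq> v' p"
          using selections_directed[OF v(1,3)] by blast
        then show ?thesis
          using selections_mono(2)[OF v(1) v''(1,2) pol(2)] selections_mono(2)[OF v(3) v''(1,3) pol(2)] v
          by blast
      qed
      have D: "?D \<noteq> {}" "?D \<subseteq> S"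
        using selections_nonempty selections_eval_S L by auto
      obtain u where u: "u \<in> X" "w \<subseteq> u" "u \<inter> ?D = {}" "\<forall>v\<in>selections I. eval H v f \<in> u"
        by (rule selections_compact[OF pol(1) L(1) 2(2) D dir disj])
      \<comment> \<open>The induction hypotheses are used contrapositively: \<open>u\<close>
        contains every value of \<open>f\<close> and no value of \<open>g\<close>.\<close>
      have "u \<in> eval U (closed_val I) f"
        using Imp.IH(1)[OF L(1) u(1) pol(1)] u(4) by blast
      moreover have "u \<notin> eval U (closed_val I) g"
        using Imp.IH(4)[OF L(2) u(1) pol(2)] u(3) by blast
      ultimately show False
        using 2(4) u by (auto intro: eval_U_X[OF upval_closed_val])
    qed
  }
next
  case (Neg f)
  {
    case 1
    then obtain u where u: "u \<in> X" "w \<subseteq> u" "u \<in> eval U (closed_val I) f"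
      by (auto intro: eval_U_X[OF upval_closed_val])
    then obtain v where v: "v \<in> selections I" "eval H v f \<in> u"
      using Neg.IH(2)[of u] 1 by auto
    then have "eval H v (Neg f) \<notin> w" using ng_in_X_contr[OF u(1)] u(2) by auto
    then show ?case using v by blast
  next
    case 2
    have L: "syms f \<subseteq> L" "SNeg \<in> L" and pol: "polar True f"
      using 2 by auto
    show ?case
    proof (rule ccontr)
      assume neg: "\<not> ?case"
      have disj: "\<not> e \<sqinter> eval H v f \<preceq> d" if d: "e \<in> w" "v \<in> selections I" "d \<in> {bt H}" for e v d
      proof
        assume "e \<sqinter> eval H v f \<preceq> d"
        then have "e \<preceq> eval H v (Neg f)"
          using d L fil_S[OF X_fil[OF 2(2)]] selections_eval_S by (simp add: le_ng_iff)
        then have "eval H v (Neg f) \<in> w"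
          using fil_up[OF X_fil[OF 2(2)]] d 2(1) selections_eval_S by blast
        then show False using neg d by blast
      qed
      have "bt H \<in> S"
        using S_bot_if_ng[OF L(2)] selections_nonempty selections_S by blast
      then have D: "{bt H} \<noteq> {}" "{bt H} \<subseteq> S" by simp_all
      have dir: "\<exists>e\<in>{bt H}. c \<preceq> e \<and> d \<preceq> e" if "c \<in> {bt H}" "d \<in> {bt H}" for c d
        using that by simp
      obtain u where u: "u \<in> X" "w \<subseteq> u" "u \<inter> {bt H} = {}" "\<forall>v\<in>selections I. eval H v f \<in> u"
        by (rule selections_compact[OF pol L(1) 2(2) D dir disj])
      have "u \<in> eval U (closed_val I) f"
        using Neg.IH(1)[OF L(1) u(1) pol] u(4) by blast
      then show False
        using 2(4) u by (auto intro: eval_U_X[OF upval_closed_val])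
    qed
  }
qed

text \<open>This is the quantifier "for all sufficiently small selections". Directedness makes it
  stable under finite conjunctions, so finitely many approximations can be realised by one
  selection.\<close>

definition eventually_sel :: "((nat \<Rightarrow> 'a) \<Rightarrow> bool) \<Rightarrow> bool" where
  "eventually_sel Q \<longleftrightarrow>
    (\<exists>v\<in>selections I. \<forall>v'\<in>selections I. (\<forall>p. v' p \<preceq> v p) \<longrightarrow> Q v')"

lemma eventually_selI: "(\<And>v. v \<in> selections I \<Longrightarrow> Q v) \<Longrightarrow> eventually_sel Q"
  using selections_nonempty unfolding eventually_sel_def by blast

lemma eventually_sel_mono:
  "eventually_sel Q \<Longrightarrow> (\<And>v. v \<in> selections I \<Longrightarrow> Q v \<Longrightarrow> R v) \<Longrightarrow> eventually_sel R"
  unfolding eventually_sel_def by blast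

lemma eventually_sel_conj:
  assumes "eventually_sel Q" "eventually_sel R"
  shows "eventually_sel (\<lambda>v. Q v \<and> R v)"
proof -
  obtain v v' where v: "v \<in> selections I" "\<And>u. u \<in> selections I \<Longrightarrow> \<forall>p. u p \<preceq> v p \<Longrightarrow> Q u"
    and v': "v' \<in> selections I" "\<And>u. u \<in> selections I \<Longrightarrow> \<forall>p. u p \<preceq> v' p \<Longrightarrow> R u"
    using assms unfolding eventually_sel_def by blast
  obtain v'' where v'': "v'' \<in> selections I" "\<And>p. v'' p \<preceq> v p" "\<And>p. v'' p \<preceq> v' p"
    using selections_directed[OF v(1) v'(1)] by blast
  have le: "u p \<preceq> v p" "u p \<preceq> v' p" if "u \<in> selections I" "\<forall>p. u p \<preceq> v'' p" for u p
    using le_trans[of "u p" "v'' p"] that v(1) v'(1) v'' selections_S by simp_all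
  have "Q u \<and> R u" if "u \<in> selections I" "\<forall>p. u p \<preceq> v'' p" for u
    using le[OF that] v(2)[OF that(1)] v'(2)[OF that(1)] by simp
  then show ?thesis
    unfolding eventually_sel_def using v''(1) by auto
qed

lemma eventually_sel_ball:
  "finite A \<Longrightarrow> (\<And>a. a \<in> A \<Longrightarrow> eventually_sel (Q a)) \<Longrightarrow> eventually_sel (\<lambda>v. \<forall>a\<in>A. Q a v)"
proof (induction A rule: finite_induct)
  case empty
  then show ?case by (simp add: eventually_selI)
next
  case (insert a A)
  then have "eventually_sel (\<lambda>v. Q a v \<and> (\<forall>a\<in>A. Q a v))" by (simp add: eventually_sel_conj)
  then show ?case by simp
qed

text \<open>\<open>closed_val_approx\<close> provides one selection, and monotonicity covers all
  smaller ones.\<close>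

lemma eventually_positive:
  assumes "syms f \<subseteq> L" "w \<in> X" "positive f" "w \<notin> eval U (closed_val I) f"
  shows "eventually_sel (\<lambda>v. eval H v f \<notin> w)"
  using closed_val_approx(1)[of f w] selections_mono_mem(1)[of _ _ w f] assms
  unfolding eventually_sel_def positive_def by blast

lemma eventually_negative:
  assumes "syms f \<subseteq> L" "w \<in> X" "negative f" "w \<in> eval U (closed_val I) f"
  shows "eventually_sel (\<lambda>v. eval H v f \<in> w)"
  using closed_val_approx(2)[of f w] selections_mono_mem(2)[of _ _ w f] assms
  unfolding eventually_sel_def negative_def by blast

text \<open>The variable case depends on the valuation being closed: truth of a variable at
  \<open>w\<close> means that \<open>w\<close> contains its whole filter, so every selection
  works.\<close>

lemma eventually_sahl_ant:
  assumes w: "w \<in> X"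
  shows "sahl_ant f \<Longrightarrow> syms f \<subseteq> L \<Longrightarrow> w \<in> eval U (closed_val I) f \<Longrightarrow> eventually_sel (\<lambda>v. eval H v f \<in> w)"
proof (induction f rule: sahl_ant.induct)
  case (sa_var n)
  then show ?case by (intro eventually_selI) (auto simp: closed_val_def selections_def)
next
  case (sa_neg f)
  then show ?case using eventually_negative w by blast
next
  case sa_bot
  then show ?case by simp
next
  case sa_top
  then show ?case using w by (intro eventually_selI) (simp add: top_in_X S_tp)
next
  case (sa_and a b)
  then have "eventually_sel (\<lambda>v. eval H v a \<in> w \<and> eval H v b \<in> w)"
    by (intro eventually_sel_conj) (auto intro: eval_U_X[OF upval_closed_val])
  then show ?case
    by (rule eventually_sel_mono) (simp add: fil_meet[OF X_fil[OF w]])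
next
  case (sa_or a b)
  then have "eventually_sel (\<lambda>v. eval H v a \<in> w) \<or> eventually_sel (\<lambda>v. eval H v b \<in> w)"
    by (auto intro: eval_U_X[OF upval_closed_val])
  then show ?case
    by (elim disjE; elim eventually_sel_mono)
      (use sa_or.prems w in \<open>auto simp: join_in_X_iff selections_eval_S\<close>)
qed

text \<open>A failing implication or negation has a witness \<open>w\<close> above \<open>x\<close>.
  For small selections the same \<open>w\<close> contains the value of the antecedent but not that
  of the consequent, and inclusion of \<open>x\<close> in \<open>w\<close> carries the failure back
  to \<open>x\<close>.\<close>

lemma eventually_sahl_comb:
  assumes x: "x \<in> X"
  shows "sahl_comb f \<Longrightarrow> syms f \<subseteq> L \<Longrightarrow> x \<notin> eval U (closed_val I) f \<Longrightarrow> eventually_sel (\<lambda>v. eval H v f \<notin> x)"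
proof (induction f rule: sahl_comb.induct)
  case (sc_imp f)
  consider "positive f" | a where "f = Neg a" "sahl_ant a"
    | a b where "f = Imp a b" "sahl_ant a" "positive b"
    using sc_imp(1) unfolding sahl_imp_def by blast
  then show ?case
  proof cases
    case 1
    then show ?thesis using eventually_positive sc_imp x by blast
  next
    case (2 a)
    then obtain w where w: "w \<in> X" "x \<subseteq> w" "w \<in> eval U (closed_val I) a"
      using sc_imp(3) x by (auto intro: eval_U_X[OF upval_closed_val])
    have "eventually_sel (\<lambda>v. eval H v a \<in> w)"
      using eventually_sahl_ant[OF w(1)] 2 sc_imp w by auto
    then show ?thesis
      by (rule eventually_sel_mono) (use ng_in_X_contr[OF w(1)] w 2 in auto)
  next
    case (3 a b)
    then obtain w where w: "w \<in> X" "x \<subseteq> w" "w \<in> eval U (closed_val I) a" "w \<notin> eval U (closed_val I) b"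
      using sc_imp(3) x by (auto intro: eval_U_X[OF upval_closed_val])
    have "eventually_sel (\<lambda>v. eval H v a \<in> w \<and> eval H v b \<notin> w)"
      using eventually_sahl_ant[OF w(1)] eventually_positive[OF _ w(1)] 3 sc_imp w
      by (intro eventually_sel_conj) auto
    then show ?thesis
      by (rule eventually_sel_mono)
        (use im_in_X_mp[OF w(1)] w 3 sc_imp selections_eval_S in auto)
  qed
next
  case (sc_and a b)
  then have "eventually_sel (\<lambda>v. eval H v a \<notin> x) \<or> eventually_sel (\<lambda>v. eval H v b \<notin> x)"
    by (auto intro: eval_U_X[OF upval_closed_val])
  then show ?case
    by (elim disjE; elim eventually_sel_mono)
      (use sc_and.prems x in \<open>auto simp: meet_in_X_iff selections_eval_S\<close>)
next
  case (sc_or a b)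
  then have "eventually_sel (\<lambda>v. eval H v a \<notin> x \<and> eval H v b \<notin> x)"
    by (intro eventually_sel_conj) (auto intro: eval_U_X[OF upval_closed_val])
  then show ?case
    by (rule eventually_sel_mono)
      (use sc_or.prems x in \<open>auto simp: join_in_X_iff selections_eval_S\<close>)
qed

end

section \<open>Finitely generated valuations\<close>

text \<open>Primeness of \<open>u\<close> is tested only against filters containing
  \<open>x\<close>. This suffices for witness points, which all lie above \<open>x\<close>, and it
  holds for \<open>u = x\<close> by irreducibility alone.\<close>

definition prime_above :: "'a set \<Rightarrow> 'a set \<Rightarrow> bool" where
  "prime_above x u \<longleftrightarrow> (\<forall>F G. fil F \<longrightarrow> fil G \<longrightarrow> x \<subseteq> F \<longrightarrow> x \<subseteq> G \<longrightarrow> F \<inter> G \<subseteq> u \<longrightarrow> F \<subseteq> u \<or> G \<subseteq> u)"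

lemma prime_aboveI:
  assumes "\<And>F G a b. fil F \<Longrightarrow> fil G \<Longrightarrow> x \<subseteq> F \<Longrightarrow> x \<subseteq> G \<Longrightarrow> a \<in> F \<Longrightarrow> b \<in> G \<Longrightarrow> a \<in> S - u \<Longrightarrow> b \<in> S - u \<Longrightarrow>
    \<exists>d\<in>S - u. d \<in> F \<and> d \<in> G"
  shows "prime_above x u"
  unfolding prime_above_def
proof (intro allI impI, rule ccontr)
  fix F G assume FG: "fil F" "fil G" "x \<subseteq> F" "x \<subseteq> G" "F \<inter> G \<subseteq> u" "\<not> (F \<subseteq> u \<or> G \<subseteq> u)"
  then obtain a b where "a \<in> F" "b \<in> G" "a \<in> S - u" "b \<in> S - u"
    using fil_S by blast
  then show False using assms[OF FG(1-4)] FG(5) by blast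
qed

text \<open>The element \<open>e\<close> from \<open>X_irreducible\<close> lies in \<open>x\<close>,
  hence in both test filters, which therefore both contain \<open>c\<close>.\<close>

lemma prime_above_self:
  assumes "x \<in> X" shows "prime_above x x"
proof (rule prime_aboveI)
  fix F G a b
  assume FG: "fil F" "fil G" "x \<subseteq> F" "x \<subseteq> G" "a \<in> F" "b \<in> G" and "a \<in> S - x" "b \<in> S - x"
  then obtain e c where "e \<in> x" "c \<in> S - x" "e \<sqinter> a \<preceq> c" "e \<sqinter> b \<preceq> c"
    using X_irreducible[OF assms] by blast
  then have "c \<in> F" "c \<in> G" using FG fil_meet fil_up by (metis DiffD1 subsetD)+
  with \<open>c \<in> S - x\<close> show "\<exists>d\<in>S - x. d \<in> F \<and> d \<in> G" by blast
qed

lemma prime_above_join: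
  assumes "SOr \<in> L" "u \<in> X" shows "prime_above x u"
proof (rule prime_aboveI)
  fix F G a b
  assume "fil F" "fil G" "a \<in> F" "b \<in> G" "a \<in> S - u" "b \<in> S - u"
  moreover from this have "jn H a b \<in> S - u"
    using join_in_X_iff[OF assms] S_join[OF assms(1)] by blast
  ultimately show "\<exists>d\<in>S - u. d \<in> F \<and> d \<in> G"
    using fil_up by (intro bexI[of _ "jn H a b"]) (auto intro: fil_up)
qed

text \<open>Implication supplies a substitute for the join: the element \<open>d\<close> below is an
  upper bound of \<open>a\<close> and \<open>b\<close>. It stays outside \<open>u\<close> because
  its antecedent lies in \<open>u\<close> while \<open>c\<close> does not.\<close>

lemma prime_above_im:
  assumes "SImp \<in> L" "u \<in> X" shows "prime_above x u"
proof (rule prime_aboveI)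
  fix F G a b
  assume FG: "fil F" "fil G" "a \<in> F" "b \<in> G" and ab: "a \<in> S - u" "b \<in> S - u"
  then obtain e c where e: "e \<in> u" "c \<in> S - u" "e \<sqinter> a \<preceq> c" "e \<sqinter> b \<preceq> c"
    using X_irreducible[OF assms(2)] by blast
  have fu: "fil u" using assms by simp
  have car: "a \<in> car H" "b \<in> car H" "c \<in> car H" "e \<in> car H"
    using ab e fil_S[OF fu] by auto
  define ac bc d where "ac = im H a c" and "bc = im H b c" and "d = im H (ac \<sqinter> bc) c"
  have S: "ac \<in> S" "bc \<in> S" "d \<in> S"
    using ab e assms by (auto simp: ac_def bc_def d_def S_im)
  have "e \<preceq> ac" "e \<preceq> bc"
    using e car by (simp_all add: ac_def bc_def le_im_iff)
  then have "ac \<sqinter> bc \<in> u" using e S fil_up[OF fu] fil_meet[OF fu] by blast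
  then have "d \<notin> u" using im_in_X_mp[OF assms(2)] e unfolding d_def by blast
  have "a \<sqinter> ac \<preceq> c" "b \<sqinter> bc \<preceq> c"
    using car im_meet_le by (simp_all add: ac_def bc_def meet_commute)
  then have "a \<sqinter> (ac \<sqinter> bc) \<preceq> c" "b \<sqinter> (ac \<sqinter> bc) \<preceq> c"
    using car S meet_le_trans[of a ac c a "ac \<sqinter> bc"] meet_le_trans[of b bc c b "ac \<sqinter> bc"]
    by simp_all
  then have "a \<preceq> d" "b \<preceq> d" using car S by (simp_all add: d_def le_im_iff)
  then have "d \<in> F" "d \<in> G" using FG S fil_up by blast+
  with S \<open>d \<notin> u\<close> show "\<exists>d\<in>S - u. d \<in> F \<and> d \<in> G" by blast
qed

text \<open>Here the substitute for the join is the negation of \<open>n\<close>. Maximality puts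
  \<open>n\<close> into \<open>u\<close>, which excludes \<open>ng H n\<close>.\<close>

lemma prime_above_maximal:
  assumes "SNeg \<in> L" "u \<in> X" and max: "\<And>a. a \<in> S - u \<Longrightarrow> ng H a \<in> u"
  shows "prime_above x u"
proof (rule prime_aboveI)
  fix F G a b
  assume FG: "fil F" "fil G" "a \<in> F" "b \<in> G" and ab: "a \<in> S - u" "b \<in> S - u"
  define n d where "n = ng H a \<sqinter> ng H b" and "d = ng H n"
  have "n \<in> u" using max ab fil_meet[OF X_fil[OF assms(2)]] by (simp add: n_def)
  then have "d \<notin> u" using ng_in_X_contr[OF assms(2)] by (auto simp: d_def)
  have S: "ng H a \<in> S" "ng H b \<in> S" "n \<in> S" "d \<in> S"
    using ab S_ng[OF assms(1)] by (auto simp: n_def d_def)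
  have "n \<preceq> ng H a" "n \<preceq> ng H b" using S by (simp_all add: n_def)
  then have "n \<sqinter> a \<preceq> bt H" "n \<sqinter> b \<preceq> bt H" using ab S by (simp_all add: le_ng_iff)
  then have "a \<preceq> d" "b \<preceq> d" using ab S by (simp_all add: d_def le_ng_iff meet_commute)
  then have "d \<in> F" "d \<in> G" using FG S fil_up by blast+
  with S \<open>d \<notin> u\<close> show "\<exists>d\<in>S - u. d \<in> F \<and> d \<in> G" by blast
qed

section \<open>Comparison of closed and generated valuations\<close>

context
  fixes x :: "'a set" and W :: "'a set set" and V :: "nat \<Rightarrow> 'a set set"
  assumes x: "x \<in> X" and fin: "finite W" and W: "W \<subseteq> {w \<in> X. x \<subseteq> w}"
begin

text \<open>If no point of \<open>W\<close> lies in \<open>V p\<close>, the intersection with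
  \<open>S\<close> makes this the improper filter \<open>S\<close>, and the corresponding closed
  upset is empty.\<close>

definition common :: "nat \<Rightarrow> 'a set" where
  "common p = S \<inter> \<Inter>(W \<inter> V p)"

definition generated :: "nat \<Rightarrow> 'a set set" where
  "generated p = {u \<in> X. \<exists>w\<in>W \<inter> V p. w \<subseteq> u}"

lemma fil_S_Inter:
  assumes "A \<subseteq> W" shows "fil (S \<inter> \<Inter>A)" "x \<subseteq> S \<inter> \<Inter>A"
proof -
  show sub: "x \<subseteq> S \<inter> \<Inter>A" using W x assms fil_S[OF X_fil] by blast
  have F: "fil w" if "w \<in> A" for w using that assms W by auto
  show "fil (S \<inter> \<Inter>A)"
    unfolding fil_iff
  proof (intro conjI ballI impI)
    show "S \<inter> \<Inter>A \<noteq> {}" using sub X_fil[OF x] unfolding fil_iff by blast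
  qed (use F fil_up fil_meet in \<open>auto\<close>)
qed

lemma fil_common: "fil (common p)"
  unfolding common_def by (rule fil_S_Inter) simp

lemma upval_generated: "upval generated"
  unfolding upval_iff generated_def by blast

text \<open>Primeness relative to \<open>x\<close> peels the filters off the finite intersection one
  at a time; properness of \<open>u\<close> rules out the empty intersection.\<close>

lemma closed_val_common_iff:
  assumes u: "u \<in> X" "prime_above x u"
  shows "u \<in> closed_val common p \<longleftrightarrow> u \<in> generated p"
proof
  assume "u \<in> generated p"
  then show "u \<in> closed_val common p" by (auto simp: generated_def closed_val_def common_def)
next
  have "finite A \<Longrightarrow> A \<subseteq> W \<Longrightarrow> S \<inter> \<Inter>A \<subseteq> u \<Longrightarrow> \<exists>w\<in>A. w \<subseteq> u" for A
  proof (induction A rule: finite_induct)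
    case empty
    then show ?case using X_proper[OF u(1)] fil_S[OF X_fil[OF u(1)]] by blast
  next
    case (insert w A)
    have w: "fil w" "x \<subseteq> w" using insert.prems W by auto
    then have "w \<subseteq> S" using fil_S by blast
    then have "w \<inter> (S \<inter> \<Inter>A) \<subseteq> u" using insert.prems by auto
    then have "w \<subseteq> u \<or> S \<inter> \<Inter>A \<subseteq> u"
      using u(2) w fil_S_Inter[of A] insert.prems unfolding prime_above_def by simp
    then show ?case using insert by blast
  qed
  from this[of "W \<inter> V p"] fin
  show "u \<in> closed_val common p \<Longrightarrow> u \<in> generated p"
    by (auto simp: generated_def closed_val_def common_def)
qed

text \<open>Without disjunction and implication, meet irreducible filters need not be prime, so the two
  valuations may differ. They still agree at \<open>x\<close> and at maximal filters, and the latter determine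
  the values of negations.\<close>

lemma eval_common_iff:
  assumes L: "syms f \<subseteq> L"
  shows "x \<in> eval U (closed_val common) f \<longleftrightarrow> x \<in> eval U generated f"
proof (cases "SOr \<in> L \<or> SImp \<in> L")
  case True
  \<comment> \<open>With either connective every point is prime above \<open>x\<close>, so the two
    valuations coincide everywhere.\<close>
  then have "prime_above x u" if "u \<in> X" for u
    using that prime_above_join prime_above_im by blast
  then have "u \<in> closed_val common p \<longleftrightarrow> u \<in> generated p" if "u \<in> X" for u p
    using that closed_val_common_iff by blast
  then have "closed_val common = generated"
    using upval_sub[OF upval_closed_val] upval_sub[OF upval_generated]
    by (intro ext set_eqI) blast
  then show ?thesis by simp
next
  case False
  have neg: "eval U (closed_val common) (Neg f) = eval U generated (Neg f)"
    if "SNeg \<in> L" and agree: "\<And>m. m \<in> X \<Longrightarrow> (\<And>a. a \<in> S - m \<Longrightarrow> ng H a \<in> m) \<Longrightarrow>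
      m \<in> eval U (closed_val common) f \<longleftrightarrow> m \<in> eval U generated f" for f
  proof -
    \<comment> \<open>The two valuations play symmetric roles. If \<open>f\<close> held under
      \<open>V'\<close> at some \<open>u\<close> above \<open>w\<close>, it would persist to a
      maximal filter, where agreement makes it hold under \<open>V\<close> and contradicts the
      negation at \<open>w\<close>.\<close>
    have le: "w \<in> eval U V' (Neg f)"
      if V: "upval V" "upval V'" and w: "w \<in> eval U V (Neg f)"
        and agree: "\<And>m. m \<in> X \<Longrightarrow> (\<And>a. a \<in> S - m \<Longrightarrow> ng H a \<in> m) \<Longrightarrow>
          m \<in> eval U V f \<longleftrightarrow> m \<in> eval U V' f" for V V' w
    proof -
      have "u \<notin> eval U V' f" if u: "u \<in> X" "w \<subseteq> u" for u
      proof
        assume fu: "u \<in> eval U V' f"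
        obtain m where m: "m \<in> X" "u \<subseteq> m" "\<And>a. a \<in> S - m \<Longrightarrow> ng H a \<in> m"
          using X_maximal_extension[OF \<open>SNeg \<in> L\<close> u(1)] by blast
        then have "m \<in> eval U V f"
          using agree eval_U_persistent[OF V(2) fu] by blast
        then show False using w m u V by (auto intro: eval_U_X)
      qed
      then show ?thesis using w V by (auto intro: eval_U_X)
    qed
    show ?thesis
      using le[OF upval_closed_val upval_generated] le[OF upval_generated upval_closed_val] agree
      by blast
  qed
  \<comment> \<open>At maximal filters the variables agree by primeness, and negations reduce to
    agreement at maximal filters again.\<close>
  have maximal: "m \<in> eval U (closed_val common) f \<longleftrightarrow> m \<in> eval U generated f"
    if "SNeg \<in> L" "syms f \<subseteq> L" "m \<in> X" "\<And>a. a \<in> S - m \<Longrightarrow> ng H a \<in> m" for f m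
    using that(2-)
  proof (induction f arbitrary: m)
    case (Var p)
    then show ?case
      using closed_val_common_iff prime_above_maximal[OF \<open>SNeg \<in> L\<close>] by simp
  next
    case (Neg f)
    then show ?case using neg[OF \<open>SNeg \<in> L\<close>, of f] by simp
  qed (use False in auto)
  show ?thesis
    using L
  proof (induction f)
    case (Var p)
    then show ?case using closed_val_common_iff[OF x prime_above_self[OF x]] by simp
  next
    case (Neg f)
    then show ?case using neg[of f] maximal by simp
  qed (use False in auto)
qed

end

end

section \<open>Canonicity of Sahlqvist quasiequations\<close>

theorem theorem5p1:
  fixes L :: "sym set" and H :: "'a halg" and S :: "'a set"
    and phis :: "fm list" and y z :: nat
  assumes "SAnd \<in> L"
    and "sahlqvist_qe phis y z"
    and "qe_in_lang L phis"
    and "heyting_algebra H"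
    and "subuniverse L H S"
    and "validates (subreduct H S) phis y z"
  shows "validates (up_alg (dual_space (subreduct H S)) (\<subseteq>)) phis y z"
proof -
  interpret heyting_subreduct H L S
    using assms by unfold_locales
  have comb: "sahl_comb f" and yz: "y \<notin> vars f" "z \<notin> vars f" and L: "syms f \<subseteq> L"
    if "f \<in> set phis" for f
    using that assms(2,3) unfolding sahlqvist_qe_def qe_in_lang_def by auto
  have "y \<noteq> z" using assms(2) unfolding sahlqvist_qe_def by simp
  have main: "V y \<subseteq> V z"
    if V: "upval V" and prem: "\<And>f. f \<in> set phis \<Longrightarrow> eval U V f \<inter> V y \<subseteq> V z" for V
  proof
    fix x assume xy: "x \<in> V y"
    then have x: "x \<in> X" using upval_sub[OF V] by blast
    show "x \<in> V z"
    proof (rule ccontr)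
      assume "x \<notin> V z"
      then have V_fail: "x \<notin> eval U V f" if "f \<in> set phis" for f
        using prem[OF that] xy by blast
      obtain W where W: "finite W" "W \<subseteq> {w \<in> X. x \<subseteq> w}" and fail:
        "\<forall>V'. upval V' \<longrightarrow> (\<forall>i. V' i \<subseteq> V i \<and> W \<inter> V i \<subseteq> V' i) \<longrightarrow> (\<forall>f\<in>set phis. x \<notin> eval U V' f)"
        by (rule sahl_combs_witnesses[OF V x finite_set comb V_fail])
      \<comment> \<open>Since \<open>V i\<close> is an upset, the generated valuation stays between
        the witness points and \<open>V\<close>, so it preserves all failures at
        \<open>x\<close>.\<close>
      have "generated W V i \<subseteq> V i" "W \<inter> V i \<subseteq> generated W V i" for i
        using V W unfolding generated_def[OF x W] upval_iff by blast+
      then have "\<forall>f\<in>set phis. x \<notin> eval U (generated W V) f"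
        using fail upval_generated[OF x W] by blast
      then have closed: "x \<notin> eval U (closed_val (common W V)) f" if "f \<in> set phis" for f
        using that eval_common_iff[OF x W L] by blast
      have I: "fil (common W V p)" for p
        by (rule fil_common[OF x W])
      \<comment> \<open>There are finitely many formulas, so a single small selection makes all
        their values miss \<open>x\<close>.\<close>
      have "eventually_sel (common W V) (\<lambda>v. \<forall>f\<in>set phis. eval H v f \<notin> x)"
        by (rule eventually_sel_ball[of "common W V", OF I finite_set
          eventually_sahl_comb[of "common W V", OF I x comb L closed]])
      then obtain v where v: "v \<in> selections (common W V)" "\<forall>f\<in>set phis. eval H v f \<notin> x"
        unfolding eventually_sel_def[of "common W V", OF I]
        using selections_S[of "common W V", OF I] by (meson S_car le_refl)
      have vS: "v p \<in> S" for p using selections_S[of "common W V", OF I v(1)] .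
      have "eval H v ` set phis \<subseteq> S - x" using v(2) eval_S[of v, OF vS L] by blast
      then obtain y0 z0 where yz0: "y0 \<in> x" "z0 \<in> S - x"
        and sep: "\<And>b. b \<in> eval H v ` set phis \<Longrightarrow> b \<sqinter> y0 \<preceq> z0"
        using X_separation[OF x, of "eval H v ` set phis"] by blast
      \<comment> \<open>As \<open>y\<close> and \<open>z\<close> do not occur in the formulas, this
        update keeps their values and turns the separation by \<open>y0\<close> and
        \<open>z0\<close> into the premises of the quasiequation.\<close>
      let ?v = "v(y := y0, z := z0)"
      have y0: "y0 \<in> S" using yz0 fil_S[OF X_fil[OF x]] by blast
      have "eval H ?v f = eval H v f" if "f \<in> set phis" for f
        using yz[OF that] by (intro eval_cong) auto
      then have "eval H ?v f \<sqinter> ?v y \<preceq> ?v z" if "f \<in> set phis" for f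
        using sep that \<open>y \<noteq> z\<close> by simp
      moreover have "?v i \<in> S" for i using vS y0 yz0 by simp
      moreover have "car (subreduct H S) = S" "mt (subreduct H S) = mt H"
        by (simp_all add: subreduct_def)
      ultimately have "?v y \<preceq> ?v z"
        using assms(6) unfolding validates_def by (metis ale_subreduct eval_subreduct)
      then have "y0 \<preceq> z0" using \<open>y \<noteq> z\<close> by simp
      then show False using fil_up[OF X_fil[OF x]] yz0 by blast
    qed
  qed
  have ale_U: "ale U A B \<longleftrightarrow> A \<subseteq> B" for A B
    by (auto simp: ale_def)
  show ?thesis
    unfolding validates_def ale_U
  proof (intro allI impI)
    fix V assume "\<forall>i. V i \<in> car U" "\<forall>f\<in>set phis. mt U (eval U V f) (V y) \<subseteq> V z"
    then show "V y \<subseteq> V z" by (intro main) (simp_all add: upval_def)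
  qed
qed

end
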